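(* There is a universal constant $c>0$ such that for every real $I\ge 1$, all finite sets $\mathcal X,\mathcal Y$, every Boolean function $f:\mathcal X\times\mathcal Y\to\{0,1\}$, and every protocol distribution $p(xym)$ of communication complexity $C$ (with $xy\in\mathcal X\times\mathcal Y$), $$\mathsf M_I(p,f)\ \le\ 2C-\Big(1+\frac{12}{\delta}\Big)\cdot I\cdot\log\Big(\mathbb E_{p(m)}\Big|\mathbb E_{p(xy|m)}\big[(-1)^{f(xy)}\big]\Big|\Big)+c\,I,$$ where $\delta=1/15$.
   Context: All sets are finite, $xy$ means $(x,y)$, logs are base 2. For a joint distribution, e.g. $q(xym)$, we write $q(m),q(xy|m),q(x|ym)$, etc. for its marginals and conditionals. Protocol distribution: a distribution $p(xym)$ on inputs $xy\in\mathcal X\times\mathcal Y$ and $m=(m_0,m_1,m_2,\dots)$, where $m_0$ is the public randomness and $m_1,m_2,\dots$ are the messages (odd ones sent by Alice, even ones by Bob), such that $$p(xym)=p(xy)\cdot p(m_0)\cdot\prod_{i=1,3,5,\dots}p(m_i|xm_{<i})\cdot p(m_{i+1}|ym_{\le i}).$$ Its communication complexity is the maximum total number of bits in the messages $m_1,m_2,\dots$ ($m_0$ is not counted). A distribution $q(xym)$ is rectangular with respect to a distribution $\mu(xy)$ if $q(xym)=\mu(xy)\cdot A(xm)\cdot B(ym)$ for some functions $A,B$. Marginal information: for $I\ge1$ and $\delta=1/15$, $$\mathsf M_I(p,f)=\inf_q\sup_{xym}\log\Big(\frac{q(x|ym)}{p(x|y)}\cdot\frac{q(y|xm)}{p(y|x)}\cdot\Big(\frac{q(xym)}{p(xym)}\Big)^I\cdot\Big|\mathbb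 E_{q(xy|m)}[(-1)^{f(xy)}]\Big|^{-12I/\delta}\Big),$$ where the infimum is over all distributions $q$ that are rectangular with respect to $p(xy)$, and the supremum is over all $xym$ in the support of $q$. (Division by $0$, or a negative power of $0$, is read as $+\infty$; $-\log 0=+\infty$.)
   Formalization: Messages are bit strings, and those possible after any given history are required to be prefix-free (as in a protocol tree); without this, silence could carry unbounded information and the bound fails. The finite sets are taken as sets of natural numbers. *)

theory Defs
  imports "HOL-Probability.Probability" "HOL-Library.Sublist"
begin

text \<open>
  A joint distribution \<open>p(xym)\<close> is a pmf on triples \<open>(x, y, m)\<close>. Conditional probabilities are
  quotients, so they are \<open>0\<close> when the conditioning event is null.
\<close>

abbreviation input_marginal :: "('x \<times> 'y \<times> 'm) pmf \<Rightarrow> ('x \<times> 'y) pmf" where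
  "input_marginal p \<equiv> map_pmf (\<lambda>(x, y, m). (x, y)) p"

abbreviation msg_marginal :: "('x \<times> 'y \<times> 'm) pmf \<Rightarrow> 'm pmf" where
  "msg_marginal p \<equiv> map_pmf (\<lambda>(x, y, m). m) p"

text \<open>\<open>E\<close> of \<open>(-1)^f(xy)\<close> under \<open>p(xy|m)\<close>; only meaningful if \<open>p(m) > 0\<close>.\<close>

definition bias :: "('x \<times> 'y \<Rightarrow> nat) \<Rightarrow> ('x \<times> 'y \<times> 'm) pmf \<Rightarrow> 'm \<Rightarrow> real" where
  "bias f p m = measure_pmf.expectation (cond_pmf p {(x, y, m'). m' = m})
     (\<lambda>(x, y, m'). (- 1) ^ f (x, y))"

text \<open>
  A transcript is \<open>m = (m\<^sub>0, [m\<^sub>1, m\<^sub>2, \<dots>])\<close>: public randomness followed by messages, each of them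
  a bit string. List positions count from \<open>0\<close>, so Alice sends the entries at even positions.
\<close>

type_synonym 'r transcript = "'r \<times> bool list list"

definition prefix_free :: "'a list set \<Rightarrow> bool" where
  "prefix_free S \<longleftrightarrow> (\<forall>u\<in>S. \<forall>v\<in>S. prefix u v \<longrightarrow> u = v)"

definition next_messages ::
    "('x \<times> 'y \<times> 'r transcript) pmf \<Rightarrow> 'r \<Rightarrow> bool list list \<Rightarrow> bool list set" where
  "next_messages p r h = {w. \<exists>x y t. (x, y, r, h @ w # t) \<in> set_pmf p}"

text \<open>
  Protocols with fewer than \<open>n\<close> messages on some runs are padded with empty messages. The messages
  possible after a given history must be self-delimiting (prefix-free), as in a protocol tree;
  otherwise unlimited information could be sent in a bounded number of bits, by choosing the round
  in which a nonempty message is sent. In particular an empty message is possible only where it is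
  forced.
\<close>

definition protocol_distribution ::
    "'x set \<Rightarrow> 'y set \<Rightarrow> ('x \<times> 'y \<times> 'r transcript) pmf \<Rightarrow> bool" where
  "protocol_distribution X Y p \<longleftrightarrow>
     finite (set_pmf p) \<and> set_pmf p \<subseteq> X \<times> Y \<times> UNIV \<and>
     (\<forall>r h. prefix_free (next_messages p r h)) \<and>
     (\<exists>n. (\<forall>(x, y, r, ms) \<in> set_pmf p. length ms = n) \<and>
       (\<forall>x y r ms. length ms = n \<longrightarrow>
         pmf p (x, y, r, ms) =
           pmf (input_marginal p) (x, y) * pmf (map_pmf fst (msg_marginal p)) r *
           (\<Prod>i<n.
             if even i
             then \<P>((x', y', r', ms') in p. ms' ! i = ms ! i
                    \<bar> x' = x \<and> r' = r \<and> take i ms' = take i ms)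
             else \<P>((x', y', r', ms') in p. ms' ! i = ms ! i
                    \<bar> y' = y \<and> r' = r \<and> take i ms' = take i ms))))"

definition communication_complexity :: "('x \<times> 'y \<times> 'r transcript) pmf \<Rightarrow> nat" where
  "communication_complexity p =
     Max ((\<lambda>(x, y, r, ms). sum_list (map length ms)) ` set_pmf p)"

definition rectangular :: "('x \<times> 'y \<times> 'm) pmf \<Rightarrow> ('x \<times> 'y) pmf \<Rightarrow> bool" where
  "rectangular q \<mu> \<longleftrightarrow>
     (\<exists>(A :: 'x \<Rightarrow> 'm \<Rightarrow> real) (B :: 'y \<Rightarrow> 'm \<Rightarrow> real).
        \<forall>x y m. pmf q (x, y, m) = pmf \<mu> (x, y) * A x m * B y m)"

definition \<delta> :: real where
  "\<delta> = 1 / 15"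

text \<open>
  The logarithm in the definition of marginal information at a point \<open>(x, y, m)\<close> of the support of
  \<open>q\<close>. There the numerators are positive, so the product is \<open>\<infinity>\<close> as soon as one factor is.
\<close>

definition marginal_cost ::
    "real \<Rightarrow> ('x \<times> 'y \<times> 'm) pmf \<Rightarrow> ('x \<times> 'y \<Rightarrow> nat) \<Rightarrow> ('x \<times> 'y \<times> 'm) pmf
       \<Rightarrow> 'x \<times> 'y \<times> 'm \<Rightarrow> ereal" where
  "marginal_cost I p f q = (\<lambda>(x, y, m).
     let px = \<P>((x', y', m') in p. x' = x \<bar> y' = y);
         py = \<P>((x', y', m') in p. y' = y \<bar> x' = x);
         qx = \<P>((x', y', m') in q. x' = x \<bar> y' = y \<and> m' = m);
         qy = \<P>((x', y', m') in q. y' = y \<bar> x' = x \<and> m' = m)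
     in if px = 0 \<or> py = 0 \<or> pmf p (x, y, m) = 0 \<or> bias f q m = 0 then \<infinity>
        else ereal (log 2
          (qx / px * (qy / py) * (pmf q (x, y, m) / pmf p (x, y, m)) powr I
             * \<bar>bias f q m\<bar> powr (- (12 * I / \<delta>)))))"

text \<open>
  The infimum ranges over all pmfs on the type, not just those on the finite sets at hand: a \<open>q\<close>
  whose support is not contained in that of \<open>p\<close> has cost \<open>\<infinity>\<close>.
\<close>

definition marginal_information ::
    "real \<Rightarrow> ('x \<times> 'y \<times> 'm) pmf \<Rightarrow> ('x \<times> 'y \<Rightarrow> nat) \<Rightarrow> ereal" where
  "marginal_information I p f =
     (INF q \<in> {q. rectangular q (input_marginal p)}. SUP \<omega> \<in> set_pmf q. marginal_cost I p f q \<omega>)"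

text \<open>Base-2 logarithm of a nonnegative real, with \<open>log 0 = -\<infinity>\<close>.\<close>

definition elog2 :: "real \<Rightarrow> ereal" where
  "elog2 t = (if t = 0 then - \<infinity> else ereal (log 2 t))"

definition advantage :: "('x \<times> 'y \<Rightarrow> nat) \<Rightarrow> ('x \<times> 'y \<times> 'm) pmf \<Rightarrow> real" where
  "advantage f p = measure_pmf.expectation (msg_marginal p) (\<lambda>m. \<bar>bias f p m\<bar>)"

text \<open>
  A constant bound inside a formula with free type variables may depend on those types. To state
  that a constant is universal for all finite sets, instantiate the type variables with \<open>nat\<close>.
\<close>

end

theory Submission
  imports Defs
begin

text \<open>
  A protocol factors as \<open>p(xym) = \<mu>(xy) \<rho>(m) A(xm) B(ym)\<close> with \<open>0 \<le> A, B \<le> 1\<close>, and \<open>\<rho>(m)\<close> summed over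
  all possible transcripts is at most \<open>2^C\<close>. Restricting \<open>p(\<cdot>|m)\<close> to a rectangle \<open>S \<times> T\<close> in which
  every row and every column has relative weight at least \<open>\<tau>\<close> bounds the two ratios
  \<open>q(x|ym) / p(x|y)\<close> and \<open>q(y|xm) / p(y|x)\<close> by \<open>1 / \<tau>\<close>, and such a rectangle is obtained by deleting
  light rows and columns, at a loss of mass of at most \<open>2 \<tau>\<close>.

  Let \<open>b\<close> be the absolute bias of \<open>m\<close>. The budget allows \<open>\<tau>\<close> of order \<open>\<surd>b p(m) / \<rho>(m)\<close>, but the deletion
  may then destroy the bias. If it does, the deleted part has small mass and carries most of the bias,
  so its relative bias is at least of order \<open>\<surd>b\<close>. Deleting inside it with the smaller threshold
  \<open>\<tau>\<close> of order \<open>b p(m) / \<rho>(m)\<close> is then affordable, because the power \<open>180 = 12 / \<delta>\<close> of the larger bias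
  more than pays for the smaller \<open>\<tau>\<close>. Finally the messages are reweighted so as to equalize the cost, and
  the normalizing constant is bounded from below by a power mean argument.
\<close>

section \<open>Rectangles with heavy rows and columns\<close>

text \<open>
  The thresholds \<open>r\<close> and \<open>c\<close> are not tied to \<open>X\<close> and \<open>Y\<close>: inside a subrectangle, rows and columns are
  still compared with those of the full rectangle.
\<close>

lemma peeling:
  fixes \<mu> :: "'x \<Rightarrow> 'y \<Rightarrow> real" and A r :: "'x \<Rightarrow> real" and B c :: "'y \<Rightarrow> real"
  assumes "finite X" "finite Y"
    and \<mu>: "\<And>x y. 0 \<le> \<mu> x y"
    and A: "\<And>x. 0 \<le> A x" "\<And>x. A x \<le> 1" and B: "\<And>y. 0 \<le> B y" "\<And>y. B y \<le> 1"
    and r: "\<And>x. 0 \<le> r x" and c: "\<And>y. 0 \<le> c y" and \<tau>: "0 \<le> \<tau>"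
  obtains S T where "S \<subseteq> X" "T \<subseteq> Y"
    "\<And>x. x \<in> S \<Longrightarrow> \<tau> * r x \<le> (\<Sum>y\<in>T. \<mu> x y * B y)"
    "\<And>y. y \<in> T \<Longrightarrow> \<tau> * c y \<le> (\<Sum>x\<in>S. \<mu> x y * A x)"
    "(\<Sum>x\<in>X. \<Sum>y\<in>Y. \<mu> x y * A x * B y)
       \<le> (\<Sum>x\<in>S. \<Sum>y\<in>T. \<mu> x y * A x * B y) + \<tau> * (sum r X + sum c Y)"
proof -
  have "\<exists>S T. S \<subseteq> X \<and> T \<subseteq> Y \<and>
    (\<forall>x\<in>S. \<tau> * r x \<le> (\<Sum>y\<in>T. \<mu> x y * B y)) \<and>
    (\<forall>y\<in>T. \<tau> * c y \<le> (\<Sum>x\<in>S. \<mu> x y * A x)) \<and>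
    (\<Sum>x\<in>X. \<Sum>y\<in>Y. \<mu> x y * A x * B y)
       \<le> (\<Sum>x\<in>S. \<Sum>y\<in>T. \<mu> x y * A x * B y) + \<tau> * (sum r X + sum c Y)"
    using assms(1,2)
  \<comment> \<open>Light rows and columns are deleted one at a time until none is left. Each
    deletion is charged to the threshold of that row or column, which leaves the sums of
    \<open>r\<close> and \<open>c\<close> at the same time.\<close>
  proof (induction "card X + card Y" arbitrary: X Y rule: less_induct)
    case less
    consider (row) x where "x \<in> X" "(\<Sum>y\<in>Y. \<mu> x y * B y) < \<tau> * r x"
      | (col) y where "y \<in> Y" "(\<Sum>x\<in>X. \<mu> x y * A x) < \<tau> * c y"
      | (stable) "\<forall>x\<in>X. \<tau> * r x \<le> (\<Sum>y\<in>Y. \<mu> x y * B y)"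
          "\<forall>y\<in>Y. \<tau> * c y \<le> (\<Sum>x\<in>X. \<mu> x y * A x)"
      by (meson not_le)
    then show ?case
    proof cases
      case row
      have "card (X - {x}) + card Y < card X + card Y"
        using card_Diff1_less[OF less.prems(1) row(1)] by linarith
      from less.hyps[OF this] less.prems obtain S T where ST: "S \<subseteq> X - {x}" "T \<subseteq> Y"
        "\<forall>x\<in>S. \<tau> * r x \<le> (\<Sum>y\<in>T. \<mu> x y * B y)"
        "\<forall>y\<in>T. \<tau> * c y \<le> (\<Sum>x\<in>S. \<mu> x y * A x)"
        "(\<Sum>x\<in>X - {x}. \<Sum>y\<in>Y. \<mu> x y * A x * B y)
           \<le> (\<Sum>x\<in>S. \<Sum>y\<in>T. \<mu> x y * A x * B y) + \<tau> * (sum r (X - {x}) + sum c Y)"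
        by fastforce
      have "(\<Sum>y\<in>Y. \<mu> x y * A x * B y) = A x * (\<Sum>y\<in>Y. \<mu> x y * B y)"
        by (simp add: sum_distrib_left mult_ac)
      also have "\<dots> \<le> 1 * (\<Sum>y\<in>Y. \<mu> x y * B y)"
        by (intro mult_right_mono A sum_nonneg mult_nonneg_nonneg \<mu> B)
      finally have "(\<Sum>y\<in>Y. \<mu> x y * A x * B y) \<le> \<tau> * r x"
        using row(2) by simp
      then have "(\<Sum>x\<in>X. \<Sum>y\<in>Y. \<mu> x y * A x * B y)
           \<le> (\<Sum>x\<in>S. \<Sum>y\<in>T. \<mu> x y * A x * B y) + \<tau> * (sum r X + sum c Y)"
        using ST(5) sum.remove[OF less.prems(1) row(1), of r]
          sum.remove[OF less.prems(1) row(1), of "\<lambda>x. \<Sum>y\<in>Y. \<mu> x y * A x * B y"]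
        by (simp add: algebra_simps)
      with ST show ?thesis by blast
    next
      case col
      have "card X + card (Y - {y}) < card X + card Y"
        using card_Diff1_less[OF less.prems(2) col(1)] by linarith
      from less.hyps[OF this] less.prems obtain S T where ST: "S \<subseteq> X" "T \<subseteq> Y - {y}"
        "\<forall>x\<in>S. \<tau> * r x \<le> (\<Sum>y\<in>T. \<mu> x y * B y)"
        "\<forall>y\<in>T. \<tau> * c y \<le> (\<Sum>x\<in>S. \<mu> x y * A x)"
        "(\<Sum>x\<in>X. \<Sum>y\<in>Y - {y}. \<mu> x y * A x * B y)
           \<le> (\<Sum>x\<in>S. \<Sum>y\<in>T. \<mu> x y * A x * B y) + \<tau> * (sum r X + sum c (Y - {y}))"
        by fastforce
      have "(\<Sum>x\<in>X. \<mu> x y * A x * B y) = B y * (\<Sum>x\<in>X. \<mu> x y * A x)"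
        by (simp add: sum_distrib_left mult_ac)
      also have "\<dots> \<le> 1 * (\<Sum>x\<in>X. \<mu> x y * A x)"
        by (intro mult_right_mono A sum_nonneg mult_nonneg_nonneg \<mu> B)
      finally have "(\<Sum>x\<in>X. \<mu> x y * A x * B y) \<le> \<tau> * c y"
        using col(2) by simp
      moreover have "(\<Sum>x\<in>X. \<Sum>y\<in>Y. \<mu> x y * A x * B y) =
          (\<Sum>x\<in>X. \<mu> x y * A x * B y) + (\<Sum>x\<in>X. \<Sum>y\<in>Y - {y}. \<mu> x y * A x * B y)"
        by (simp add: sum.remove[OF less.prems(2) col(1)] sum.distrib)
      ultimately have "(\<Sum>x\<in>X. \<Sum>y\<in>Y. \<mu> x y * A x * B y)
           \<le> (\<Sum>x\<in>S. \<Sum>y\<in>T. \<mu> x y * A x * B y) + \<tau> * (sum r X + sum c Y)"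
        using ST(5) sum.remove[OF less.prems(2) col(1), of c]
        by (simp add: algebra_simps)
      with ST show ?thesis by blast
    next
      case stable
      moreover have "0 \<le> \<tau> * (sum r X + sum c Y)"
        by (intro mult_nonneg_nonneg add_nonneg_nonneg sum_nonneg r c \<tau>)
      ultimately show ?thesis
        by (intro exI[of _ X] exI[of _ Y]) auto
    qed
  qed
  with that show thesis by blast
qed

text \<open>Both differences are sums over the deleted cells, where
  \<open>\<bar>g x y\<bar> \<le> 1\<close>. So a deletion destroys at most as much discrepancy as
  mass.\<close>

lemma sum_rectangle_diff_le:
  fixes k g :: "'x \<Rightarrow> 'y \<Rightarrow> real"
  assumes "finite X" "finite Y" "S \<subseteq> X" "T \<subseteq> Y"
    and k: "\<And>x y. 0 \<le> k x y" and g: "\<And>x y. \<bar>g x y\<bar> \<le> 1"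
  shows "\<bar>(\<Sum>x\<in>X. \<Sum>y\<in>Y. k x y * g x y) - (\<Sum>x\<in>S. \<Sum>y\<in>T. k x y * g x y)\<bar>
    \<le> (\<Sum>x\<in>X. \<Sum>y\<in>Y. k x y) - (\<Sum>x\<in>S. \<Sum>y\<in>T. k x y)"
proof -
  have sub: "S \<times> T \<subseteq> X \<times> Y" and fin: "finite (X \<times> Y)" using assms by auto
  have "\<bar>\<Sum>z\<in>X \<times> Y - S \<times> T. case z of (x, y) \<Rightarrow> k x y * g x y\<bar>
      \<le> (\<Sum>z\<in>X \<times> Y - S \<times> T. case z of (x, y) \<Rightarrow> k x y)"
    by (intro sum_abs[THEN order_trans] sum_mono)
      (auto simp: abs_mult k g mult_left_le split: prod.split)
  then show ?thesis
    by (simp add: sum.cartesian_product sum_diff[OF fin sub])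
qed

text \<open>The last conjunct trades the threshold against the mass kept: \<open>\<tau>\<close> may
  fall below the order of \<open>sqrt (D X Y / W X Y) * W X Y\<close> only if \<open>W S T\<close>
  is a correspondingly small part of \<open>W X Y\<close>. The exponent 179 arises because a
  rectangle of discrepancy \<open>s\<close> and mass \<open>W\<close> is later weighted by
  \<open>W * (s / W) ^ 180\<close>, that is \<open>s ^ 180 / W ^ 179\<close>.\<close>

lemma heavy_rectangle:
  fixes \<mu> g :: "'x \<Rightarrow> 'y \<Rightarrow> real" and A :: "'x \<Rightarrow> real" and B :: "'y \<Rightarrow> real"
  assumes fin: "finite X" "finite Y"
    and \<mu>: "\<And>x y. 0 \<le> \<mu> x y" "(\<Sum>x\<in>X. \<Sum>y\<in>Y. \<mu> x y) \<le> 1"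
    and A: "\<And>x. 0 \<le> A x" "\<And>x. A x \<le> 1" and B: "\<And>y. 0 \<le> B y" "\<And>y. B y \<le> 1"
    and g: "\<And>x y. \<bar>g x y\<bar> \<le> 1"
  defines "W \<equiv> \<lambda>S T. \<Sum>x\<in>S. \<Sum>y\<in>T. \<mu> x y * A x * B y"
    and "D \<equiv> \<lambda>S T. \<bar>\<Sum>x\<in>S. \<Sum>y\<in>T. \<mu> x y * A x * B y * g x y\<bar>"
  shows "\<exists>S T \<tau>. S \<subseteq> X \<and> T \<subseteq> Y \<and> 0 < \<tau> \<and>
    (\<forall>x\<in>S. \<tau> * (\<Sum>y\<in>Y. \<mu> x y) \<le> (\<Sum>y\<in>T. \<mu> x y * B y)) \<and>
    (\<forall>y\<in>T. \<tau> * (\<Sum>x\<in>X. \<mu> x y) \<le> (\<Sum>x\<in>S. \<mu> x y * A x)) \<and>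
    D X Y \<le> 8 * D S T \<and>
    W S T ^ 179 * (D X Y / W X Y) * (W X Y)\<^sup>2 \<le> 256 * \<tau>\<^sup>2 * W X Y ^ 179"
proof -
  define G where "G = (\<lambda>S T. \<Sum>x\<in>S. \<Sum>y\<in>T. \<mu> x y * A x * B y * g x y)"
  have D_G: "D S T = \<bar>G S T\<bar>" for S T by (simp add: D_def G_def)
  have k: "0 \<le> \<mu> x y * A x * B y" for x y by (simp add: \<mu> A B)
  have Wnn: "0 \<le> W S T" for S T unfolding W_def by (intro sum_nonneg k)
  have diff: "\<bar>G X' Y' - G S T\<bar> \<le> W X' Y' - W S T"
    if "S \<subseteq> X'" "T \<subseteq> Y'" "X' \<subseteq> X" "Y' \<subseteq> Y" for X' Y' S T
    unfolding G_def W_def using that fin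
    by (intro sum_rectangle_diff_le k g) (auto intro: finite_subset)
  have DW: "D S T \<le> W S T" if "S \<subseteq> X" "T \<subseteq> Y" for S T
    using diff[of "{}" S "{}" T] that by (simp add: D_G) (simp add: G_def W_def)
  show ?thesis
  proof (cases "D X Y = 0")
    case True
    \<comment> \<open>Without discrepancy the empty rectangle will do, with any positive
      threshold.\<close>
    have "D {} {} = 0" "W {} {} = 0" by (simp_all add: D_def W_def)
    with True show ?thesis
      by (intro exI[of _ "{}"] exI[of _ 1]) (simp add: Wnn)
  next
    case False
    define W0 D0 b where "W0 = W X Y" and "D0 = D X Y" and "b = D0 / W0"
    have D0: "0 < D0" using False by (simp add: D0_def D_G)
    have W0: "D0 \<le> W0" "0 < W0" using DW[of X Y] D0 by (auto simp: D0_def W0_def)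
    have b: "0 < b" "b \<le> 1" and bW: "b * W0 = D0" using D0 W0 by (auto simp: b_def)
    let ?r = "\<lambda>x. \<Sum>y\<in>Y. \<mu> x y" and ?c = "\<lambda>y. \<Sum>x\<in>X. \<mu> x y"
    \<comment> \<open>The row masses and the column masses of \<open>\<mu>\<close> each sum to at
      most 1, so the total charge is at most \<open>2 * \<tau>\<close>.\<close>
    have peel: "\<exists>S T. S \<subseteq> X' \<and> T \<subseteq> Y' \<and>
        (\<forall>x\<in>S. \<tau> * ?r x \<le> (\<Sum>y\<in>T. \<mu> x y * B y)) \<and>
        (\<forall>y\<in>T. \<tau> * ?c y \<le> (\<Sum>x\<in>S. \<mu> x y * A x)) \<and>
        W X' Y' \<le> W S T + 2 * \<tau>"
      if sub: "X' \<subseteq> X" "Y' \<subseteq> Y" and \<tau>: "0 < \<tau>" for X' Y' \<tau>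
    proof -
      have "finite X'" "finite Y'" using sub fin by (auto intro: finite_subset)
      moreover have "0 \<le> ?r x" "0 \<le> ?c y" for x y by (auto intro: sum_nonneg \<mu>)
      ultimately obtain S T where
        ST: "S \<subseteq> X'" "T \<subseteq> Y'" "\<And>x. x \<in> S \<Longrightarrow> \<tau> * ?r x \<le> (\<Sum>y\<in>T. \<mu> x y * B y)"
        "\<And>y. y \<in> T \<Longrightarrow> \<tau> * ?c y \<le> (\<Sum>x\<in>S. \<mu> x y * A x)"
        "W X' Y' \<le> W S T + \<tau> * (sum ?r X' + sum ?c Y')"
        unfolding W_def using peeling[of X' Y' \<mu> A B ?r ?c \<tau>, OF _ _ \<mu>(1) A B] less_imp_le[OF \<tau>]
        by blast
      have "sum ?r X' \<le> sum ?r X" "sum ?c Y' \<le> sum ?c Y"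
        using sub fin by (auto intro!: sum_mono2 sum_nonneg \<mu>)
      moreover have "sum ?c Y = sum ?r X" by (rule sum.swap)
      ultimately have "sum ?r X' + sum ?c Y' \<le> 2" using \<mu>(2) by linarith
      then have "\<tau> * (sum ?r X' + sum ?c Y') \<le> \<tau> * 2" using \<tau> by (intro mult_left_mono) auto
      with ST show ?thesis by (intro exI[of _ S] exI[of _ T]) auto
    qed
    \<comment> \<open>The deleted mass is then at most \<open>sqrt b * W0 / 2\<close>, so a deleted
      part with a quarter of the discrepancy has relative bias at least
      \<open>sqrt b / 2\<close>.\<close>
    define \<tau>1 where "\<tau>1 = sqrt b * W0 / 4"
    have \<tau>1: "0 < \<tau>1" "\<tau>1\<^sup>2 = b * W0\<^sup>2 / 16"
      using b W0 by (auto simp: \<tau>1_def power_divide power_mult_distrib)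
    from peel[OF order_refl order_refl \<tau>1(1)] obtain S T where ST: "S \<subseteq> X" "T \<subseteq> Y"
      "\<forall>x\<in>S. \<tau>1 * ?r x \<le> (\<Sum>y\<in>T. \<mu> x y * B y)"
      "\<forall>y\<in>T. \<tau>1 * ?c y \<le> (\<Sum>x\<in>S. \<mu> x y * A x)" and WST: "W0 \<le> W S T + 2 * \<tau>1"
      unfolding W0_def by blast
    have WST': "W S T \<le> W0" using diff[of S X T Y] ST by (auto simp: W0_def)
    show ?thesis
    proof (cases "D0 \<le> 2 * D S T")
      case True
      have "W S T ^ 179 * b * W0\<^sup>2 \<le> W0 ^ 179 * b * W0\<^sup>2"
        by (intro mult_right_mono power_mono WST' Wnn) (use b in auto)
      also have "\<dots> \<le> 256 * (b * W0\<^sup>2 / 16) * W0 ^ 179" using b W0 by simp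
      finally have "W S T ^ 179 * b * W0\<^sup>2 \<le> 256 * \<tau>1\<^sup>2 * W0 ^ 179" by (simp only: \<tau>1)
      moreover have "D0 \<le> 8 * D S T" using True D0 by linarith
      ultimately show ?thesis
        using ST \<tau>1(1)
        by (intro exI[of _ S] exI[of _ T] exI[of _ \<tau>1]) (auto simp: b_def D0_def W0_def)
    next
      case False
      \<comment> \<open>The complement of \<open>S \<times> T\<close> is a union of two disjoint
        rectangles. As \<open>S \<times> T\<close> holds less than half of the discrepancy, one of
        them holds at least a quarter.\<close>
      have split: "(\<Sum>x\<in>X. \<Sum>y\<in>Y. h x y) =
          (\<Sum>x\<in>S. \<Sum>y\<in>T. h x y) + (\<Sum>x\<in>X - S. \<Sum>y\<in>Y. h x y) + (\<Sum>x\<in>S. \<Sum>y\<in>Y - T. h x y)"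
        for h :: "'x \<Rightarrow> 'y \<Rightarrow> real"
        by (simp add: sum.subset_diff[OF ST(1) fin(1)] sum.subset_diff[OF ST(2) fin(2)] sum.distrib)
      have "G X Y = G S T + G (X - S) Y + G S (Y - T)" unfolding G_def by (rule split)
      moreover have Wsplit: "W0 = W S T + W (X - S) Y + W S (Y - T)"
        unfolding W0_def W_def by (rule split)
      ultimately have "D0 \<le> 4 * D (X - S) Y \<or> D0 \<le> 4 * D S (Y - T)"
        using False unfolding D0_def D_G by linarith
      moreover have "W (X - S) Y \<le> 2 * \<tau>1" "W S (Y - T) \<le> 2 * \<tau>1"
        using Wsplit WST Wnn[of "X - S" Y] Wnn[of S "Y - T"] by linarith+
      ultimately obtain X' Y' where XY': "X' \<subseteq> X" "Y' \<subseteq> Y" "D0 \<le> 4 * D X' Y'" "W X' Y' \<le> 2 * \<tau>1"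
        using ST by (metis Diff_subset order_refl)
      \<comment> \<open>Peeling with \<open>\<tau>2\<close> removes mass at most
        \<open>D0 / 8\<close>, so of a discrepancy of at least \<open>D0 / 4\<close> at least
        \<open>D0 / 8\<close> survives.\<close>
      define \<tau>2 where "\<tau>2 = D0 / 16"
      have \<tau>2: "0 < \<tau>2" using D0 by (simp add: \<tau>2_def)
      from peel[OF XY'(1,2) this] obtain S' T' where S'T': "S' \<subseteq> X'" "T' \<subseteq> Y'"
        "\<forall>x\<in>S'. \<tau>2 * ?r x \<le> (\<Sum>y\<in>T'. \<mu> x y * B y)"
        "\<forall>y\<in>T'. \<tau>2 * ?c y \<le> (\<Sum>x\<in>S'. \<mu> x y * A x)" "W X' Y' \<le> W S' T' + 2 * \<tau>2"
        by blast
      have d: "\<bar>G X' Y' - G S' T'\<bar> \<le> W X' Y' - W S' T'" using diff S'T' XY' by blast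
      have D': "D0 \<le> 8 * D S' T'"
        using d S'T'(5) XY'(3) unfolding D_G \<tau>2_def by linarith
      define v where "v = W S' T' / W0"
      have "W S' T' \<le> 2 * \<tau>1" using d XY'(4) by linarith
      moreover have "0 \<le> sqrt b * W0" using b W0 by simp
      ultimately have "W S' T' \<le> sqrt b * W0" unfolding \<tau>1_def by linarith
      then have v: "0 \<le> v" "v \<le> sqrt b" using W0 Wnn by (auto simp: v_def field_simps)
      \<comment> \<open>The square of \<open>\<tau>2\<close> is of order
        \<open>b\<^sup>2 * W0\<^sup>2\<close> instead of \<open>b * W0\<^sup>2\<close>; the bound
        \<open>v ^ 179 \<le> b\<close> supplies the missing factor.\<close>
      have "v\<^sup>2 \<le> b" using power_mono[OF v(2,1), of 2] b by simp
      moreover have "v ^ 179 \<le> v ^ 2"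
      proof (rule power_decreasing)
        show "v \<le> 1" using v(2) b by (meson order_trans real_sqrt_le_1_iff)
      qed (use v in auto)
      ultimately have "v ^ 179 \<le> b" by linarith
      then have "W S' T' ^ 179 \<le> b * W0 ^ 179"
        using W0 by (simp add: v_def power_divide field_simps)
      then have "W S' T' ^ 179 * (b * W0\<^sup>2) \<le> (b * W0 ^ 179) * (b * W0\<^sup>2)"
        using b by (intro mult_right_mono) auto
      also have "\<dots> = 256 * \<tau>2\<^sup>2 * W0 ^ 179"
        by (simp add: \<tau>2_def bW[symmetric] power_divide power2_eq_square)
      finally show ?thesis
        using S'T' XY' \<tau>2 D'
        by (intro exI[of _ S'] exI[of _ T'] exI[of _ \<tau>2])
          (auto simp: b_def D0_def W0_def mult_ac)
    qed
  qed
qed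

section \<open>Protocols\<close>

text \<open>Padding with \<open>False\<close> to length \<open>n\<close> is injective: two words
  with the same padding are prefixes of one string, hence comparable, hence equal.\<close>

lemma prefix_free_card_le:
  fixes S :: "bool list set"
  assumes "prefix_free S" and len: "\<And>w. w \<in> S \<Longrightarrow> length w \<le> n"
  shows "card S \<le> 2 ^ n"
proof -
  let ?pad = "\<lambda>w. w @ replicate (n - length w) False"
  have "inj_on ?pad S"
  proof (rule inj_onI)
    fix u v assume "u \<in> S" "v \<in> S" "?pad u = ?pad v"
    then show "u = v"
      using assms(1) unfolding prefix_free_def by (metis prefixI prefix_same_cases)
  qed
  moreover have "?pad ` S \<subseteq> {w. set w \<subseteq> UNIV \<and> length w = n}" using len by auto
  ultimately have "card S \<le> card {w :: bool list. set w \<subseteq> UNIV \<and> length w = n}"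
    by (rule card_inj_on_le) (rule finite_lists_length_eq[OF finite])
  also have "\<dots> = 2 ^ n" by (simp only: card_lists_length_eq[OF finite] card_UNIV_bool)
  finally show ?thesis .
qed

text \<open>The public randomness is held fixed because it is not counted as communication; it
  enters later through its probability.\<close>

lemma card_transcripts_le:
  assumes "protocol_distribution X Y p"
  shows "card {ms. (r, ms) \<in> set_pmf (msg_marginal p)} \<le> 2 ^ communication_complexity p"
proof -
  define M where "M = {ms. (r, ms) \<in> set_pmf (msg_marginal p)}"
  have fin: "finite (set_pmf p)" and pf: "\<And>h. prefix_free (next_messages p r h)"
    using assms by (auto simp: protocol_distribution_def)
  obtain n where n: "\<And>x y r ms. (x, y, r, ms) \<in> set_pmf p \<Longrightarrow> length ms = n"
    using assms unfolding protocol_distribution_def by fast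
  \<comment> \<open>Concatenating the messages is an injective encoding of transcripts by a prefix-free code.\<close>
  have code: "ms = ms'" if "ms \<in> M" "ms' \<in> M" "prefix (concat ms) (concat ms')" for ms ms'
  proof (rule ccontr)
    assume "ms \<noteq> ms'"
    \<comment> \<open>Equal length forces a first differing entry. There \<open>w\<close> and
      \<open>w'\<close> are both possible after the common history \<open>h\<close>, and once
      \<open>h\<close> is stripped both are prefixes of the same string.\<close>
    moreover have "length ms = length ms'" using that n by (auto simp: M_def)
    ultimately obtain h w w' t t' where
      eq: "ms = h @ [w] @ t" "ms' = h @ [w'] @ t'" and ne: "w \<noteq> w'"
      by (metis same_length_different)
    then have "w \<in> next_messages p r h" "w' \<in> next_messages p r h"
      using that by (auto simp: M_def next_messages_def)
    moreover have "prefix w (w' @ concat t')"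
      using that(3) by (auto simp: eq intro: prefix_order.trans append_prefixD)
    then have "prefix w w' \<or> prefix w' w"
      by (metis prefixI prefix_same_cases)
    ultimately show False using pf ne unfolding prefix_free_def by blast
  qed
  have "card M = card (concat ` M)"
    by (intro card_image[symmetric] inj_onI code) auto
  also have "\<dots> \<le> 2 ^ communication_complexity p"
  proof (rule prefix_free_card_le)
    show "prefix_free (concat ` M)" using code by (auto simp: prefix_free_def)
    fix w assume "w \<in> concat ` M"
    then obtain x y ms where "(x, y, r, ms) \<in> set_pmf p" "w = concat ms"
      by (auto simp: M_def)
    moreover have "length (concat ms) = sum_list (map length ms)" by (simp add: length_concat)
    ultimately show "length w \<le> communication_complexity p"
      unfolding communication_complexity_def
      by (intro Max_ge) (force simp: fin)+
  qed
  finally show ?thesis by (simp add: M_def)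
qed

text \<open>For a fixed transcript, splitting the product by the parity of the round separates the
  factors that depend on \<open>x\<close> from those that depend on \<open>y\<close>.\<close>

lemma protocol_factorization:
  fixes p :: "('x \<times> 'y \<times> 'r transcript) pmf"
  assumes "protocol_distribution X Y p"
  obtains A :: "'x \<Rightarrow> 'r transcript \<Rightarrow> real" and B :: "'y \<Rightarrow> 'r transcript \<Rightarrow> real" where
    "\<And>x m. 0 \<le> A x m" "\<And>x m. A x m \<le> 1" "\<And>y m. 0 \<le> B y m" "\<And>y m. B y m \<le> 1"
    "\<And>x y m. pmf p (x, y, m) = pmf (input_marginal p) (x, y)
       * pmf (map_pmf fst (msg_marginal p)) (fst m) * A x m * B y m"
proof -
  obtain n where n: "\<And>x y r ms. (x, y, r, ms) \<in> set_pmf p \<Longrightarrow> length ms = n"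
    and eq: "\<And>x y r ms. length ms = n \<Longrightarrow> pmf p (x, y, r, ms) =
           pmf (input_marginal p) (x, y) * pmf (map_pmf fst (msg_marginal p)) r *
           (\<Prod>i<n.
             if even i
             then \<P>((x', y', r', ms') in p. ms' ! i = ms ! i
                    \<bar> x' = x \<and> r' = r \<and> take i ms' = take i ms)
             else \<P>((x', y', r', ms') in p. ms' ! i = ms ! i
                    \<bar> y' = y \<and> r' = r \<and> take i ms' = take i ms))"
    using assms unfolding protocol_distribution_def by fast
  let ?a = "\<lambda>x r ms i. \<P>((x', y', r', ms') in p. ms' ! i = ms ! i
      \<bar> x' = x \<and> r' = r \<and> take i ms' = take i ms)"
  let ?b = "\<lambda>y r ms i. \<P>((x', y', r', ms') in p. ms' ! i = ms ! i
      \<bar> y' = y \<and> r' = r \<and> take i ms' = take i ms)"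
  have cp: "0 \<le> \<P>(\<omega> in p. P \<omega> \<bar> Q \<omega>)" "\<P>(\<omega> in p. P \<omega> \<bar> Q \<omega>) \<le> 1" for P Q
    by (auto simp: cond_prob_def intro!: divide_le_eq_1[THEN iffD2] measure_pmf.finite_measure_mono
        simp: zero_less_measure_iff)
  \<comment> \<open>The product formula is available only for lists of length \<open>n\<close>. On
    all others \<open>p\<close> vanishes, and \<open>A\<close> is set to 0 to match.\<close>
  define A where "A = (\<lambda>x (r, ms). if length ms = n then \<Prod>i<n. if even i then ?a x r ms i else 1 else 0)"
  define B where "B = (\<lambda>y (r, ms). \<Prod>i<n. if even i then 1 else ?b y r ms i)"
  show thesis
  proof
    show "0 \<le> A x m" "A x m \<le> 1" for x m
      by (auto simp: A_def cp split: prod.split intro!: prod_nonneg prod_le_1)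
    show "0 \<le> B y m" "B y m \<le> 1" for y m
      by (auto simp: B_def cp split: prod.split intro!: prod_nonneg prod_le_1)
    show "pmf p (x, y, m) = pmf (input_marginal p) (x, y)
       * pmf (map_pmf fst (msg_marginal p)) (fst m) * A x m * B y m" for x y m
    proof (cases m)
      case (Pair r ms)
      show ?thesis
      proof (cases "length ms = n")
        case True
        have "(\<Prod>i<n. if even i then ?a x r ms i else ?b y r ms i) = A x m * B y m"
          by (auto simp: A_def B_def Pair True prod.distrib[symmetric] intro!: prod.cong)
        then show ?thesis using eq[OF True, of x y r] by (simp add: Pair mult.assoc)
      next
        case False
        then have "(x, y, r, ms) \<notin> set_pmf p" using n by blast
        then show ?thesis using False by (simp add: A_def Pair set_pmf_iff)
      qed
    qed
  qed
qed

section \<open>Marginals and conditionals of finitely supported distributions\<close>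

text \<open>An event that fixes only the message may be infinite; its mass sits on the finitely many
  points with inputs in \<open>X\<close> and \<open>Y\<close>.\<close>

lemma measure_pmf_eq_sum:
  assumes "finite F" "F \<subseteq> E" "E \<inter> set_pmf q \<subseteq> F"
  shows "measure_pmf.prob q E = sum (pmf q) F"
proof -
  have "E \<inter> set_pmf q = F \<inter> set_pmf q" using assms by auto
  then have "measure_pmf.prob q E = measure_pmf.prob q F" by (metis measure_Int_set_pmf)
  then show ?thesis using assms(1) by (simp add: measure_measure_pmf_finite)
qed

lemma cond_prob_pmf:
  "\<P>(\<omega> in measure_pmf q. P \<omega> \<bar> Q \<omega>)
    = measure_pmf.prob q {\<omega>. P \<omega> \<and> Q \<omega>} / measure_pmf.prob q {\<omega>. Q \<omega>}"
  by (simp add: cond_prob_def)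

lemma ex_pmf_eq:
  assumes "finite F" and nonneg: "\<And>z. 0 \<le> f z" and zero: "\<And>z. z \<notin> F \<Longrightarrow> f z = 0"
    and one: "sum f F = (1 :: real)"
  obtains q where "pmf q = f"
proof
  have "(\<integral>\<^sup>+ z. ennreal (f z) \<partial>count_space UNIV) = (\<Sum>z\<in>F. ennreal (f z))"
    using assms by (intro nn_integral_count_space') auto
  also have "\<dots> = 1" by (simp add: sum_ennreal nonneg one)
  finally show "pmf (embed_pmf f) = f" by (intro ext pmf_embed_pmf nonneg)
qed

context
  fixes q :: "('x \<times> 'y \<times> 'm) pmf" and X :: "'x set" and Y :: "'y set"
  assumes fin: "finite X" "finite Y" and supp: "set_pmf q \<subseteq> X \<times> Y \<times> UNIV"
begin

lemma prob_msg_eq_sum: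
  "measure_pmf.prob q {(x, y, m'). m' = m} = (\<Sum>x\<in>X. \<Sum>y\<in>Y. pmf q (x, y, m))"
proof -
  have "measure_pmf.prob q {(x, y, m'). m' = m} = sum (pmf q) ((\<lambda>(x, y). (x, y, m)) ` (X \<times> Y))"
    using fin supp by (intro measure_pmf_eq_sum) auto
  also have "\<dots> = (\<Sum>(x, y)\<in>X \<times> Y. pmf q (x, y, m))"
    by (subst sum.reindex) (auto simp: inj_on_def intro!: sum.cong)
  finally show ?thesis by (simp add: sum.cartesian_product)
qed

lemma pmf_msg_marginal_eq_sum:
  "pmf (msg_marginal q) m = (\<Sum>x\<in>X. \<Sum>y\<in>Y. pmf q (x, y, m))"
  unfolding prob_msg_eq_sum[symmetric] pmf_map by (rule arg_cong[of _ _ "measure_pmf.prob q"]) auto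

lemma bias_eq_quotient:
  assumes "m \<in> set_pmf (msg_marginal q)"
  shows "bias f q m = (\<Sum>x\<in>X. \<Sum>y\<in>Y. pmf q (x, y, m) * (- 1) ^ f (x, y))
    / (\<Sum>x\<in>X. \<Sum>y\<in>Y. pmf q (x, y, m))"
proof -
  let ?E = "{(x :: 'x, y :: 'y, m'). m' = m}"
  have ne: "set_pmf q \<inter> ?E \<noteq> {}" using assms by auto
  have "bias f q m = (\<Sum>z\<in>(\<lambda>(x, y). (x, y, m)) ` (X \<times> Y).
      (case z of (x, y, m) \<Rightarrow> (- 1) ^ f (x, y)) * pmf (cond_pmf q ?E) z)"
    unfolding bias_def using fin supp
    by (intro integral_measure_pmf_real) (auto simp: set_cond_pmf[OF ne])
  also have "\<dots> = (\<Sum>(x, y)\<in>X \<times> Y. (- 1) ^ f (x, y) * (pmf q (x, y, m) / measure_pmf.prob q ?E))"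
    by (subst sum.reindex) (auto simp: inj_on_def pmf_cond[OF ne] intro!: sum.cong)
  finally show ?thesis
    unfolding prob_msg_eq_sum by (simp add: sum.cartesian_product sum_divide_distrib mult_ac split_def)
qed

lemma cond_prob_input_given_msg:
  assumes "x \<in> X" "y \<in> Y"
  shows "\<P>((x', y', m') in q. x' = x \<bar> y' = y \<and> m' = m) = pmf q (x, y, m) / (\<Sum>x'\<in>X. pmf q (x', y, m))"
    and "\<P>((x', y', m') in q. y' = y \<bar> x' = x \<and> m' = m) = pmf q (x, y, m) / (\<Sum>y'\<in>Y. pmf q (x, y', m))"
proof -
  have 1: "{\<omega>. (case \<omega> of (x', y', m') \<Rightarrow> x' = x) \<and> (case \<omega> of (x', y', m') \<Rightarrow> y' = y \<and> m' = m)}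
      = {(x, y, m)}"
    "{\<omega>. (case \<omega> of (x', y', m') \<Rightarrow> y' = y) \<and> (case \<omega> of (x', y', m') \<Rightarrow> x' = x \<and> m' = m)}
      = {(x, y, m)}"
    by auto
  have 2: "measure_pmf.prob q {(x', y', m'). y' = y \<and> m' = m} = sum (pmf q) ((\<lambda>x. (x, y, m)) ` X)"
    "measure_pmf.prob q {(x', y', m'). x' = x \<and> m' = m} = sum (pmf q) ((\<lambda>y. (x, y, m)) ` Y)"
    using fin supp assms by (intro measure_pmf_eq_sum; auto)+
  show "\<P>((x', y', m') in q. x' = x \<bar> y' = y \<and> m' = m) = pmf q (x, y, m) / (\<Sum>x'\<in>X. pmf q (x', y, m))"
    "\<P>((x', y', m') in q. y' = y \<bar> x' = x \<and> m' = m) = pmf q (x, y, m) / (\<Sum>y'\<in>Y. pmf q (x, y', m))"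
    unfolding cond_prob_pmf 1 2 by (simp_all add: measure_pmf_single sum.reindex inj_on_def)
qed

lemma cond_prob_input:
  assumes "x \<in> X" "y \<in> Y"
  shows "\<P>((x', y', m') in q. x' = x \<bar> y' = y)
      = pmf (input_marginal q) (x, y) / (\<Sum>x'\<in>X. pmf (input_marginal q) (x', y))"
    and "\<P>((x', y', m') in q. y' = y \<bar> x' = x)
      = pmf (input_marginal q) (x, y) / (\<Sum>y'\<in>Y. pmf (input_marginal q) (x, y'))"
proof -
  have 1: "measure_pmf.prob q {\<omega>. (case \<omega> of (x', y', m') \<Rightarrow> x' = x) \<and> (case \<omega> of (x', y', m') \<Rightarrow> y' = y)}
      = pmf (input_marginal q) (x, y)"
    "measure_pmf.prob q {\<omega>. (case \<omega> of (x', y', m') \<Rightarrow> y' = y) \<and> (case \<omega> of (x', y', m') \<Rightarrow> x' = x)}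
      = pmf (input_marginal q) (x, y)"
    unfolding pmf_map by (rule arg_cong[of _ _ "measure_pmf.prob q"]; auto)+
  have "measure_pmf.prob q {(x', y', m'). y' = y} = measure_pmf.prob (input_marginal q) {(x', y'). y' = y}"
    "measure_pmf.prob q {(x', y', m'). x' = x} = measure_pmf.prob (input_marginal q) {(x', y'). x' = x}"
    unfolding measure_map_pmf by (rule arg_cong[of _ _ "measure_pmf.prob q"]; auto)+
  moreover have "measure_pmf.prob (input_marginal q) {(x', y'). y' = y}
      = sum (pmf (input_marginal q)) ((\<lambda>x. (x, y)) ` X)"
    "measure_pmf.prob (input_marginal q) {(x', y'). x' = x}
      = sum (pmf (input_marginal q)) ((\<lambda>y. (x, y)) ` Y)"
    using fin supp assms by (intro measure_pmf_eq_sum; auto)+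
  ultimately show "\<P>((x', y', m') in q. x' = x \<bar> y' = y)
      = pmf (input_marginal q) (x, y) / (\<Sum>x'\<in>X. pmf (input_marginal q) (x', y))"
    "\<P>((x', y', m') in q. y' = y \<bar> x' = x)
      = pmf (input_marginal q) (x, y) / (\<Sum>y'\<in>Y. pmf (input_marginal q) (x, y'))"
    unfolding cond_prob_pmf 1 by (simp_all add: sum.reindex inj_on_def)
qed

end

section \<open>The weight of a message\<close>

text \<open>A convex power lies above its tangent at \<open>s\<close>; this is Bernoulli's
  inequality for \<open>a / s - 1\<close>, rescaled.\<close>

lemma power_Suc_tangent:
  fixes a s :: real
  assumes "0 \<le> a" "0 < s"
  shows "real (Suc n) * a * s ^ n \<le> a ^ Suc n + real n * s ^ Suc n"
proof -
  have "1 + real (Suc n) * (a / s - 1) \<le> (1 + (a / s - 1)) ^ Suc n"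
    using assms by (intro Bernoulli_inequality) auto
  then have "(1 + real (Suc n) * (a / s - 1)) * s ^ Suc n \<le> (a / s) ^ Suc n * s ^ Suc n"
    using assms by (intro mult_right_mono) auto
  also have "(a / s) ^ Suc n * s ^ Suc n = a ^ Suc n"
    using assms by (simp only: power_divide) simp
  also have "(1 + real (Suc n) * (a / s - 1)) * s ^ Suc n = real (Suc n) * a * s ^ n - real n * s ^ Suc n"
    using assms by (simp add: field_simps)
  finally show ?thesis by simp
qed

text \<open>Bounds the share of one message in the normalizing constant: \<open>W0\<close> and
  \<open>D\<close> belong to the full rectangle, \<open>W\<close> and \<open>s\<close> to the chosen
  one. The weight is \<open>s ^ 180 / W ^ 179 * \<tau> powr (2 / I)\<close>, and the power
  \<open>W ^ 179\<close> in \<open>thr\<close> cancels the denominator.\<close>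

lemma rectangle_weight_ge:
  fixes W0 W D s \<tau> N I :: real
  assumes "0 < W0" "0 \<le> W" "W \<le> W0" "0 \<le> D" "D \<le> W0" "s \<le> W" "D \<le> 8 * s" "0 < \<tau>" "0 < N" "1 \<le> I"
    and thr: "W ^ 179 * (D / W0) * W0\<^sup>2 \<le> 256 * \<tau>\<^sup>2 * W0 ^ 179"
  shows "W0 * (D / W0) ^ 181 * min 1 (W0 * N) ^ 180 * N powr (- (2 / I)) / (8 ^ 180 * 256)
    \<le> W * ((s / W) ^ 180 * \<tau> powr (2 / I))"
proof (cases "D = 0")
  case True
  then show ?thesis using assms by simp
next
  case False
  define b v t u where "b = D / W0" and "v = W / W0" and "t = W0 * N" and "u = min 1 t"
  have s: "0 < s" and W: "0 < W" using False assms by auto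
  have b: "0 < b" "b \<le> 1" and v: "0 < v" "v \<le> 1" and t: "0 < t" and u: "0 < u" "u \<le> 1" "u \<le> t"
    using False W assms by (auto simp: b_def v_def t_def u_def)
  \<comment> \<open>The cap at 1 in \<open>u\<close> ensures \<open>e \<le> 1\<close>, hence
    \<open>e \<le> e powr (1 / I)\<close>. So only \<open>N\<close> keeps an exponent that depends
    on \<open>I\<close>.\<close>
  define e where "e = v ^ 179 * b * u\<^sup>2 / 256"
  have e: "0 < e" "e \<le> 1"
  proof -
    have "v ^ 179 \<le> 1" "u\<^sup>2 \<le> 1" using v u by (auto intro: power_le_one)
    then have "v ^ 179 * b * u\<^sup>2 \<le> 1" using b v by (intro mult_le_one mult_nonneg_nonneg) auto
    then show "e \<le> 1" by (simp add: e_def)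
    show "0 < e" using b v u by (simp add: e_def)
  qed
  have "v ^ 179 * b * W0\<^sup>2 \<le> 256 * \<tau>\<^sup>2"
    using thr assms(1) by (simp add: v_def b_def power_divide field_simps)
  then have "v ^ 179 * b * W0\<^sup>2 * N\<^sup>2 \<le> 256 * \<tau>\<^sup>2 * N\<^sup>2" by (intro mult_right_mono) auto
  moreover have "v ^ 179 * b * u\<^sup>2 \<le> v ^ 179 * b * t\<^sup>2"
    using b v u by (intro mult_left_mono power_mono) auto
  ultimately have e_le: "e \<le> (\<tau> * N)\<^sup>2" by (simp add: e_def t_def power_mult_distrib mult_ac)
  have "e = e powr 1" using e by simp
  also have "\<dots> \<le> e powr (1 / I)" using e assms by (intro powr_mono') auto
  also have "\<dots> \<le> ((\<tau> * N)\<^sup>2) powr (1 / I)" using e_le e assms by (intro powr_mono2) auto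
  also have "\<dots> = \<tau> powr (2 / I) * N powr (2 / I)"
    using assms by (simp add: powr_mult powr_powr flip: powr_numeral)
  finally have \<tau>: "e * N powr (- (2 / I)) \<le> \<tau> powr (2 / I)"
    using assms by (simp add: powr_minus field_simps)
  \<comment> \<open>The exponent is raised because \<open>b ^ 181 * u ^ 180\<close> equals
    \<open>(b * u) ^ 181 / u\<close>, the form that suits the power mean argument.\<close>
  have "u ^ 180 \<le> u\<^sup>2" using u by (intro power_decreasing) auto
  then have "W0 * b ^ 181 * u ^ 180 * N powr (- (2 / I)) / (8 ^ 180 * 256)
      \<le> W0 * b ^ 181 * u\<^sup>2 * N powr (- (2 / I)) / (8 ^ 180 * 256)"
    using assms b by (intro divide_right_mono mult_right_mono mult_left_mono) auto
  also have "\<dots> = ((D / 8) ^ 180 / W ^ 179) * (e * N powr (- (2 / I)))"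
  proof -
    have "b * W0 = D" "v * W0 = W" using assms by (auto simp: b_def v_def)
    then have D: "D = b * W0" "W = v * W0" by simp_all
    have "W0 ^ 180 = W0 * W0 ^ 179" "b ^ 181 = b * b ^ 180" by (simp_all flip: power_Suc)
    then show ?thesis using assms(1) v
      by (simp add: e_def D power_divide power_mult_distrib)
  qed
  also have "\<dots> \<le> (s ^ 180 / W ^ 179) * \<tau> powr (2 / I)"
    using assms W e by (intro mult_mono \<tau> divide_right_mono power_mono) auto
  also have "s ^ 180 / W ^ 179 = W * (s / W) ^ 180"
  proof -
    have "W ^ 180 = W * W ^ 179" by (simp flip: power_Suc)
    then show ?thesis using W by (simp add: power_divide)
  qed
  finally show ?thesis by (simp add: b_def u_def t_def mult.assoc)
qed

section \<open>The restricted and reweighted distribution\<close>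

lemma sum_if_rectangle:
  fixes g :: "'x \<Rightarrow> 'y \<Rightarrow> real"
  assumes "finite X" "finite Y" "S \<subseteq> X" "T \<subseteq> Y"
  shows "(\<Sum>x\<in>X. \<Sum>y\<in>Y. if x \<in> S \<and> y \<in> T then g x y else 0) = (\<Sum>x\<in>S. \<Sum>y\<in>T. g x y)"
proof -
  have "(\<Sum>x\<in>X. \<Sum>y\<in>Y. if x \<in> S \<and> y \<in> T then g x y else 0)
      = (\<Sum>x\<in>X. if x \<in> S then \<Sum>y\<in>Y. if y \<in> T then g x y else 0 else 0)"
    by (intro sum.cong) auto
  then show ?thesis
    using assms by (simp add: sum.inter_restrict[symmetric] Int_absorb1)
qed

text \<open>\<open>\<rho>\<close> is kept apart from \<open>A\<close> and \<open>B\<close> so that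
  these stay at most 1; for a protocol it is the probability of the public randomness.\<close>

locale factored_distribution =
  fixes p :: "('x \<times> 'y \<times> 'm) pmf" and X :: "'x set" and Y :: "'y set"
    and \<rho> :: "'m \<Rightarrow> real" and A :: "'x \<Rightarrow> 'm \<Rightarrow> real" and B :: "'y \<Rightarrow> 'm \<Rightarrow> real"
  assumes fin: "finite X" "finite Y" "finite (set_pmf p)"
    and supp: "set_pmf p \<subseteq> X \<times> Y \<times> UNIV"
    and \<rho>: "\<And>m. 0 \<le> \<rho> m"
    and A: "\<And>x m. 0 \<le> A x m" "\<And>x m. A x m \<le> 1"
    and B: "\<And>y m. 0 \<le> B y m" "\<And>y m. B y m \<le> 1"
    and factor: "\<And>x y m. pmf p (x, y, m) = pmf (input_marginal p) (x, y) * \<rho> m * A x m * B y m"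
begin

abbreviation \<mu> :: "'x \<Rightarrow> 'y \<Rightarrow> real" where
  "\<mu> x y \<equiv> pmf (input_marginal p) (x, y)"

abbreviation M :: "'m set" where
  "M \<equiv> set_pmf (msg_marginal p)"

text \<open>The factor \<open>\<rho> m\<close> is left out: it cancels in the bias, and for a
  possible message \<open>mass X Y m\<close> is the probability of \<open>m\<close> divided by
  \<open>\<rho> m\<close>.\<close>

definition mass :: "'x set \<Rightarrow> 'y set \<Rightarrow> 'm \<Rightarrow> real" where
  "mass S T m = (\<Sum>x\<in>S. \<Sum>y\<in>T. \<mu> x y * A x m * B y m)"

definition discrepancy :: "('x \<times> 'y \<Rightarrow> nat) \<Rightarrow> 'x set \<Rightarrow> 'y set \<Rightarrow> 'm \<Rightarrow> real" where
  "discrepancy f S T m = \<bar>\<Sum>x\<in>S. \<Sum>y\<in>T. \<mu> x y * A x m * B y m * (- 1) ^ f (x, y)\<bar>"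

lemma mass_nonneg: "0 \<le> mass S T m"
  unfolding mass_def by (intro sum_nonneg mult_nonneg_nonneg A B) auto

lemma discrepancy_le_mass: "discrepancy f S T m \<le> mass S T m"
  unfolding discrepancy_def mass_def
  by (intro order_trans[OF sum_abs] sum_mono) (simp add: abs_mult A B power_abs)

lemma finite_M: "finite M"
  using fin by simp

lemma pmf_msg: "pmf (msg_marginal p) m = \<rho> m * mass X Y m"
  unfolding pmf_msg_marginal_eq_sum[OF fin(1,2) supp] factor mass_def
  by (simp add: sum_distrib_left mult_ac)

lemma sum_\<mu>: "(\<Sum>x\<in>X. \<Sum>y\<in>Y. \<mu> x y) = 1"
proof -
  have "set_pmf (input_marginal p) \<subseteq> X \<times> Y" using supp by auto
  then have "(\<Sum>z\<in>X \<times> Y. pmf (input_marginal p) z) = 1"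
    using fin by (intro sum_pmf_eq_1) auto
  then show ?thesis by (simp add: sum.cartesian_product)
qed

lemma abs_bias:
  assumes "m \<in> M"
  shows "\<bar>bias f p m\<bar> = discrepancy f X Y m / mass X Y m"
proof -
  have "\<rho> m * mass X Y m \<noteq> 0" using assms by (metis pmf_msg set_pmf_iff)
  then have "\<rho> m \<noteq> 0" by auto
  moreover have "bias f p m
      = (\<rho> m * (\<Sum>x\<in>X. \<Sum>y\<in>Y. \<mu> x y * A x m * B y m * (- 1) ^ f (x, y))) / (\<rho> m * mass X Y m)"
    unfolding bias_eq_quotient[OF fin(1,2) supp assms] factor mass_def
    by (simp add: sum_distrib_left mult_ac)
  ultimately show ?thesis
    by (simp add: abs_mult discrepancy_def mass_nonneg)
qed

lemma advantage_eq:
  "advantage f p = (\<Sum>m\<in>M. pmf (msg_marginal p) m * (discrepancy f X Y m / mass X Y m))"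
  unfolding advantage_def
  by (subst integral_measure_pmf_real[OF finite_M]) (auto simp: abs_bias mult_ac intro!: sum.cong)

text \<open>
  The weight \<open>h\<close> is chosen so that the bound on the cost at \<open>(x, y, m)\<close> does not depend on \<open>m\<close>.
\<close>

lemma marginal_information_le_normalizer:
  fixes S :: "'m \<Rightarrow> 'x set" and T :: "'m \<Rightarrow> 'y set" and \<tau> :: "'m \<Rightarrow> real" and I :: real
    and f :: "'x \<times> 'y \<Rightarrow> nat"
  defines "h \<equiv> \<lambda>m. (discrepancy f (S m) (T m) m / mass (S m) (T m) m) ^ 180 * \<tau> m powr (2 / I)"
  defines "Z \<equiv> \<Sum>m\<in>M. \<rho> m * (mass (S m) (T m) m * h m)"
  assumes sub: "\<And>m. S m \<subseteq> X" "\<And>m. T m \<subseteq> Y" and \<tau>: "\<And>m. 0 < \<tau> m"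
    and row: "\<And>x m. x \<in> S m \<Longrightarrow> \<tau> m * (\<Sum>y\<in>Y. \<mu> x y) \<le> (\<Sum>y\<in>T m. \<mu> x y * B y m)"
    and col: "\<And>y m. y \<in> T m \<Longrightarrow> \<tau> m * (\<Sum>x\<in>X. \<mu> x y) \<le> (\<Sum>x\<in>S m. \<mu> x y * A x m)"
    and I: "0 < I" and Z: "0 < Z"
  shows "marginal_information I p f \<le> ereal (- I * log 2 Z)"
proof -
  have h: "0 \<le> h m" for m by (simp add: h_def discrepancy_def mass_nonneg)
  \<comment> \<open>The witness \<open>q\<close>: \<open>p\<close> restricted to the rectangle of
    each message, reweighted by \<open>h\<close> and normalized by \<open>Z\<close>.\<close>
  define k where "k = (\<lambda>(x, y, m). if x \<in> S m \<and> y \<in> T m then pmf p (x, y, m) * h m / Z else 0)"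
  have k_sum: "(\<Sum>x\<in>X. \<Sum>y\<in>Y. k (x, y, m) * g x y)
      = \<rho> m * h m / Z * (\<Sum>x\<in>S m. \<Sum>y\<in>T m. \<mu> x y * A x m * B y m * g x y)" for m g
  proof -
    have "(\<Sum>x\<in>X. \<Sum>y\<in>Y. k (x, y, m) * g x y)
        = (\<Sum>x\<in>X. \<Sum>y\<in>Y. if x \<in> S m \<and> y \<in> T m then pmf p (x, y, m) * h m / Z * g x y else 0)"
      by (intro sum.cong) (auto simp: k_def)
    also have "\<dots> = (\<Sum>x\<in>S m. \<Sum>y\<in>T m. pmf p (x, y, m) * h m / Z * g x y)"
      by (rule sum_if_rectangle[OF fin(1,2) sub])
    finally show ?thesis by (simp add: factor sum_distrib_left mult_ac)
  qed
  have k_mass: "(\<Sum>x\<in>X. \<Sum>y\<in>Y. k (x, y, m)) = \<rho> m * h m / Z * mass (S m) (T m) m" for m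
    using k_sum[where g = "\<lambda>_ _. 1"] by (simp add: mass_def)
  have "(\<Sum>z\<in>X \<times> Y \<times> M. k z) = (\<Sum>m\<in>M. \<Sum>x\<in>X. \<Sum>y\<in>Y. k (x, y, m))"
  proof -
    have "(\<Sum>z\<in>X \<times> Y \<times> M. k z) = (\<Sum>x\<in>X. \<Sum>y\<in>Y. \<Sum>m\<in>M. k (x, y, m))"
      by (simp add: sum.cartesian_product split_def)
    also have "\<dots> = (\<Sum>x\<in>X. \<Sum>m\<in>M. \<Sum>y\<in>Y. k (x, y, m))" by (intro sum.cong refl sum.swap)
    also have "\<dots> = (\<Sum>m\<in>M. \<Sum>x\<in>X. \<Sum>y\<in>Y. k (x, y, m))" by (rule sum.swap)
    finally show ?thesis .
  qed
  also have "\<dots> = Z / Z" unfolding k_mass Z_def sum_divide_distrib by (intro sum.cong) auto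
  finally have one: "sum k (X \<times> Y \<times> M) = 1" using Z by simp
  have "k z = 0" if "z \<notin> X \<times> Y \<times> M" for z
  proof -
    have "z \<notin> set_pmf p" using that supp by (cases z) force
    then show ?thesis by (auto simp: k_def set_pmf_iff split: prod.split)
  qed
  moreover have "0 \<le> k z" for z using Z by (auto simp: k_def h split: prod.split)
  moreover have "finite (X \<times> Y \<times> M)" using fin by auto
  ultimately obtain q where q: "pmf q = k" using one ex_pmf_eq[of "X \<times> Y \<times> M" k] by blast
  have supp_q: "set_pmf q \<subseteq> X \<times> Y \<times> UNIV"
    using subsetD[OF sub(1)] subsetD[OF sub(2)] by (auto simp: set_pmf_eq q k_def split: if_splits)
  \<comment> \<open>Everything that depends on \<open>m\<close> alone is put into Alice's
    factor.\<close>
  have "rectangular q (input_marginal p)"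
    unfolding rectangular_def
    by (intro exI[of _ "\<lambda>x m. if x \<in> S m then \<rho> m * A x m * h m / Z else 0"]
        exI[of _ "\<lambda>y m. if y \<in> T m then B y m else 0"])
      (auto simp: q k_def factor)
  moreover have "marginal_cost I p f q \<omega> \<le> ereal (- I * log 2 Z)" if \<omega>: "\<omega> \<in> set_pmf q" for \<omega>
  proof (cases \<omega>)
    case (fields x y m)
    have "k (x, y, m) \<noteq> 0" using \<omega> by (simp add: set_pmf_iff q fields)
    then have xy: "x \<in> S m" "y \<in> T m" and p0: "pmf p (x, y, m) \<noteq> 0" and h0: "h m \<noteq> 0"
      by (auto simp: k_def split: if_splits)
    then have pos: "0 < h m" "0 < \<mu> x y" "0 < \<rho> m" "0 < A x m" "0 < B y m"
      using h \<rho> A B by (auto simp: factor less_le)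
    have xyXY: "x \<in> X" "y \<in> Y" using xy sub by auto
    define a b \<beta> where "a = (\<Sum>x'\<in>S m. \<mu> x' y * A x' m)" and "b = (\<Sum>y'\<in>T m. \<mu> x y' * B y' m)"
      and "\<beta> = discrepancy f (S m) (T m) m / mass (S m) (T m) m"
    have h_eq: "h m = \<beta> ^ 180 * \<tau> m powr (2 / I)" by (simp add: h_def \<beta>_def)
    have "0 \<le> \<beta>" by (simp add: \<beta>_def discrepancy_def mass_nonneg)
    \<comment> \<open>A message without discrepancy has weight 0, so on the support of
      \<open>q\<close> the bias is nonzero and the cost finite.\<close>
    moreover have "\<beta> \<noteq> 0" using h0 by (auto simp: h_eq)
    ultimately have \<beta>: "0 < \<beta>" by simp
    have "\<mu> x y \<le> (\<Sum>x\<in>X. \<mu> x y)" "\<mu> x y \<le> (\<Sum>y\<in>Y. \<mu> x y)"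
      by (rule member_le_sum; use fin xyXY in simp)+
    then have sums: "0 < (\<Sum>x\<in>X. \<mu> x y)" "0 < (\<Sum>y\<in>Y. \<mu> x y)" using pos by linarith+
    have ab: "0 < a" "0 < b" "\<tau> m * (\<Sum>x\<in>X. \<mu> x y) \<le> a" "\<tau> m * (\<Sum>y\<in>Y. \<mu> x y) \<le> b"
      using row[OF xy(1)] col[OF xy(2)] mult_pos_pos[OF \<tau> sums(1), of m] mult_pos_pos[OF \<tau> sums(2), of m]
      unfolding a_def b_def by linarith+
    have "(\<Sum>x'\<in>X. k (x', y, m)) = (\<Sum>x'\<in>X. if x' \<in> S m then \<rho> m * B y m * h m / Z * (\<mu> x' y * A x' m) else 0)"
      using xy by (intro sum.cong) (auto simp: k_def factor)
    then have "(\<Sum>x'\<in>X. k (x', y, m)) = \<rho> m * B y m * h m / Z * a"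
      by (simp only: sum.inter_restrict[OF fin(1), symmetric] Int_absorb1[OF sub(1)] a_def sum_distrib_left)
    moreover have "(\<Sum>y'\<in>Y. k (x, y', m)) = (\<Sum>y'\<in>Y. if y' \<in> T m then \<rho> m * A x m * h m / Z * (\<mu> x y' * B y' m) else 0)"
      using xy by (intro sum.cong) (auto simp: k_def factor)
    then have "(\<Sum>y'\<in>Y. k (x, y', m)) = \<rho> m * A x m * h m / Z * b"
      by (simp only: sum.inter_restrict[OF fin(2), symmetric] Int_absorb1[OF sub(2)] b_def sum_distrib_left)
    \<comment> \<open>All factors except \<open>\<mu>\<close> and the factor of the conditioned
      variable cancel, weight included.\<close>
    ultimately have qxy:
      "\<P>((x', y', m') in q. x' = x \<bar> y' = y \<and> m' = m) = \<mu> x y * A x m / a"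
      "\<P>((x', y', m') in q. y' = y \<bar> x' = x \<and> m' = m) = \<mu> x y * B y m / b"
      unfolding cond_prob_input_given_msg[OF fin(1,2) supp_q xyXY] q
      using pos Z xy by (simp_all add: k_def factor)
    have pxy: "\<P>((x', y', m') in p. x' = x \<bar> y' = y) = \<mu> x y / (\<Sum>x\<in>X. \<mu> x y)"
      "\<P>((x', y', m') in p. y' = y \<bar> x' = x) = \<mu> x y / (\<Sum>y\<in>Y. \<mu> x y)"
      by (rule cond_prob_input[OF fin(1,2) supp xyXY])+
    have m: "m \<in> set_pmf (msg_marginal q)" using \<omega> fields by force
    have "\<bar>bias f q m\<bar> = \<bar>\<rho> m * h m / Z * (\<Sum>x\<in>S m. \<Sum>y\<in>T m. \<mu> x y * A x m * B y m * (- 1) ^ f (x, y))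
        / (\<rho> m * h m / Z * mass (S m) (T m) m)\<bar>"
      unfolding bias_eq_quotient[OF fin(1,2) supp_q m] q k_sum k_mass ..
    also have "\<dots> = \<beta>"
      using pos Z by (simp add: abs_mult \<beta>_def discrepancy_def mass_nonneg)
    finally have bias: "\<bar>bias f q m\<bar> = \<beta>" .
    have ratio: "pmf q (x, y, m) / pmf p (x, y, m) = h m / Z"
      using xy p0 by (simp add: q k_def)
    \<comment> \<open>This is the ratio of \<open>q(x|ym)\<close> to \<open>p(x|y)\<close>: the
      column is heavy and \<open>A\<close> is at most 1.\<close>
    have "A x m * (\<Sum>x\<in>X. \<mu> x y) / a \<le> 1 / \<tau> m"
    proof -
      have "A x m * ((\<Sum>x\<in>X. \<mu> x y) * \<tau> m) \<le> 1 * a"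
        using A sums(1) \<tau>[of m] ab by (intro mult_mono) (auto simp: mult.commute)
      then show ?thesis using ab \<tau>[of m] by (simp add: field_simps)
    qed
    moreover have "B y m * (\<Sum>y\<in>Y. \<mu> x y) / b \<le> 1 / \<tau> m"
    proof -
      have "B y m * ((\<Sum>y\<in>Y. \<mu> x y) * \<tau> m) \<le> 1 * b"
        using B sums(2) \<tau>[of m] ab by (intro mult_mono) (auto simp: mult.commute)
      then show ?thesis using ab \<tau>[of m] by (simp add: field_simps)
    qed
    ultimately have "(A x m * (\<Sum>x\<in>X. \<mu> x y) / a) * (B y m * (\<Sum>y\<in>Y. \<mu> x y) / b)
        \<le> 1 / \<tau> m * (1 / \<tau> m)"
      using pos ab sums \<tau>[of m] by (intro mult_mono) auto
    then have "(A x m * (\<Sum>x\<in>X. \<mu> x y) / a) * (B y m * (\<Sum>y\<in>Y. \<mu> x y) / b)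
          * (h m / Z) powr I * \<beta> powr (- (180 * I))
        \<le> 1 / \<tau> m * (1 / \<tau> m) * (h m / Z) powr I * \<beta> powr (- (180 * I))"
      by (intro mult_right_mono) auto
    \<comment> \<open>In \<open>h m powr I\<close> the square of \<open>\<tau> m\<close> cancels the
      two ratios and \<open>\<beta> powr (180 * I)\<close> cancels the bias penalty.\<close>
    also have "\<dots> = Z powr (- I)"
    proof -
      have "(h m / Z) powr I = (\<beta> powr 180 * \<tau> m powr (2 / I)) powr I / Z powr I"
        using \<beta> \<tau>[of m] Z by (simp add: h_eq powr_divide)
      also have "\<dots> = \<beta> powr (180 * I) * (\<tau> m)\<^sup>2 / Z powr I"
        using \<beta> \<tau>[of m] I by (simp add: powr_mult powr_powr del: powr_numeral flip: powr_numeral)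
      finally show ?thesis
        using \<beta> \<tau>[of m] Z by (simp add: powr_minus power2_eq_square field_simps)
    qed
    finally have "log 2 ((A x m * (\<Sum>x\<in>X. \<mu> x y) / a) * (B y m * (\<Sum>y\<in>Y. \<mu> x y) / b)
          * (h m / Z) powr I * \<beta> powr (- (180 * I))) \<le> log 2 (Z powr (- I))"
      using pos ab sums \<beta> Z by (intro log_mono) (auto intro!: mult_pos_pos divide_pos_pos)
    also have "\<dots> = - I * log 2 Z" using Z by (simp add: log_powr)
    finally have "log 2 ((A x m * (\<Sum>x\<in>X. \<mu> x y) / a) * (B y m * (\<Sum>y\<in>Y. \<mu> x y) / b)
          * (h m / Z) powr I * \<beta> powr (- (180 * I))) \<le> - I * log 2 Z" .
    moreover have "\<mu> x y * A x m / a / (\<mu> x y / (\<Sum>x\<in>X. \<mu> x y)) = A x m * (\<Sum>x\<in>X. \<mu> x y) / a"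
      "\<mu> x y * B y m / b / (\<mu> x y / (\<Sum>y\<in>Y. \<mu> x y)) = B y m * (\<Sum>y\<in>Y. \<mu> x y) / b"
      using pos by (simp_all add: field_simps)
    moreover have "12 * I / \<delta> = 180 * I" by (simp add: \<delta>_def)
    moreover have "bias f q m \<noteq> 0" using bias \<beta> by auto
    ultimately show ?thesis
      unfolding fields marginal_cost_def Let_def case_prod_conv qxy pxy bias ratio
      using pos sums p0 by simp
  qed
  ultimately show ?thesis
    unfolding marginal_information_def by (intro INF_lower2[of q] SUP_least) auto
qed

text \<open>It suffices that \<open>Z\<close> is at least
  \<open>advantage f p ^ 181 * N powr (- (2 / I)) / 2 ^ 728\<close>: the factor \<open>I\<close> in
  front of \<open>log 2 Z\<close> then turns the power of \<open>N\<close> into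
  \<open>2 * log 2 N\<close>.\<close>

lemma marginal_information_le_advantage:
  fixes I N :: real and f :: "'x \<times> 'y \<Rightarrow> nat"
  assumes I: "1 \<le> I" and N: "0 < N" "(\<Sum>m\<in>M. \<rho> m) \<le> N" and adv: "0 < advantage f p"
  shows "marginal_information I p f
    \<le> ereal (2 * log 2 N - 181 * I * log 2 (advantage f p) + 728 * I)"
proof -
  define G where "G = (\<lambda>m S T \<tau>. S \<subseteq> X \<and> T \<subseteq> Y \<and> 0 < \<tau> \<and>
    (\<forall>x\<in>S. \<tau> * (\<Sum>y\<in>Y. \<mu> x y) \<le> (\<Sum>y\<in>T. \<mu> x y * B y m)) \<and>
    (\<forall>y\<in>T. \<tau> * (\<Sum>x\<in>X. \<mu> x y) \<le> (\<Sum>x\<in>S. \<mu> x y * A x m)) \<and>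
    discrepancy f X Y m \<le> 8 * discrepancy f S T m \<and>
    mass S T m ^ 179 * (discrepancy f X Y m / mass X Y m) * (mass X Y m)\<^sup>2
      \<le> 256 * \<tau>\<^sup>2 * mass X Y m ^ 179)"
  have "\<exists>S T \<tau>. G m S T \<tau>" for m
    using heavy_rectangle[of X Y \<mu> "\<lambda>x. A x m" "\<lambda>y. B y m" "\<lambda>x y. (- 1) ^ f (x, y)"]
    unfolding G_def mass_def discrepancy_def
    by (simp add: fin A B sum_\<mu> power_abs)
  then obtain S T \<tau> where "\<And>m. G m (S m) (T m) (\<tau> m)" by metis
  note good = this[unfolded G_def]
  define w where "w = (\<lambda>m. mass (S m) (T m) m *
    ((discrepancy f (S m) (T m) m / mass (S m) (T m) m) ^ 180 * \<tau> m powr (2 / I)))"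
  define Z where "Z = (\<Sum>m\<in>M. \<rho> m * w m)"
  define P b u where "P = pmf (msg_marginal p)" and "b = (\<lambda>m. discrepancy f X Y m / mass X Y m)"
    and "u = (\<lambda>m. min 1 (mass X Y m * N))"
  \<comment> \<open>Under the weights \<open>P m / u m\<close>, of total at most 2, the values
    \<open>b m * u m\<close> sum to \<open>a\<close>. Their mean is thus at least
    \<open>a / 2\<close>, which serves as the tangent point.\<close>
  define a s where "a = advantage f p" and "s = a / 2"
  have s: "0 < s" using adv by (simp add: s_def a_def)
  have pos: "0 < \<rho> m" "0 < mass X Y m" if "m \<in> M" for m
  proof -
    have "\<rho> m * mass X Y m \<noteq> 0" using that by (metis pmf_msg set_pmf_iff)
    then show "0 < \<rho> m" "0 < mass X Y m" using \<rho>[of m] mass_nonneg[of X Y m] by (auto simp: less_le)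
  qed
  have u: "0 < u m" if "m \<in> M" for m using pos[OF that] N by (simp add: u_def)
  have b: "0 \<le> b m" for m by (simp add: b_def discrepancy_def mass_nonneg)
  \<comment> \<open>Since \<open>mass X Y m\<close> is \<open>P m / \<rho> m\<close>, the cap costs
    at most \<open>\<rho> m / N\<close> extra per message, and these extras sum to at most
    1.\<close>
  have "(\<Sum>m\<in>M. P m / u m) \<le> (\<Sum>m\<in>M. P m + \<rho> m / N)"
  proof (rule sum_mono)
    fix m assume m: "m \<in> M"
    have "1 / u m \<le> 1 + 1 / (mass X Y m * N)" using pos[OF m] N by (auto simp: u_def min_def)
    then have "P m * (1 / u m) \<le> P m * (1 + 1 / (mass X Y m * N))"
      unfolding P_def by (intro mult_left_mono) auto
    also have "P m * (1 + 1 / (mass X Y m * N)) = P m + \<rho> m / N"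
      using pos[OF m] N by (simp add: P_def pmf_msg distrib_left)
    finally show "P m / u m \<le> P m + \<rho> m / N" by simp
  qed
  also have "\<dots> = 1 + (\<Sum>m\<in>M. \<rho> m) / N"
    using sum_pmf_eq_1[OF finite_M order_refl] by (simp add: sum.distrib P_def sum_divide_distrib)
  also have "\<dots> \<le> 2" using N by simp
  finally have sum_u: "(\<Sum>m\<in>M. P m / u m) \<le> 2" .
  \<comment> \<open>The tangent of \<open>z \<mapsto> z^181\<close> at \<open>s\<close>, evaluated at \<open>b m * u m\<close> and weighted by \<open>P m / u m\<close>.\<close>
  have "(\<Sum>m\<in>M. 181 * s ^ 180 * (P m * b m)) \<le> (\<Sum>m\<in>M. P m * b m ^ 181 * u m ^ 180 + 180 * s ^ 181 * (P m / u m))"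
  proof (rule sum_mono)
    fix m assume m: "m \<in> M"
    have "181 * (b m * u m) * s ^ 180 \<le> (b m * u m) ^ 181 + 180 * s ^ 181"
      using power_Suc_tangent[of "b m * u m" s 180] b[of m] u[OF m] s by simp
    then have "P m / u m * (181 * (b m * u m) * s ^ 180) \<le> P m / u m * ((b m * u m) ^ 181 + 180 * s ^ 181)"
      using u[OF m] by (intro mult_left_mono) (auto simp: P_def)
    moreover have "(b m * u m) ^ 181 = b m ^ 181 * (u m * u m ^ 180)"
      by (simp add: power_mult_distrib flip: power_Suc)
    ultimately show "181 * s ^ 180 * (P m * b m) \<le> P m * b m ^ 181 * u m ^ 180 + 180 * s ^ 181 * (P m / u m)"
      using u[OF m] by (simp add: distrib_left mult_ac)
  qed
  also have "\<dots> = (\<Sum>m\<in>M. P m * b m ^ 181 * u m ^ 180) + 180 * s ^ 181 * (\<Sum>m\<in>M. P m / u m)"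
    by (simp add: sum.distrib sum_distrib_left)
  also have "\<dots> \<le> (\<Sum>m\<in>M. P m * b m ^ 181 * u m ^ 180) + 180 * s ^ 181 * 2"
    using s by (intro add_left_mono mult_left_mono sum_u) auto
  finally have "181 * s ^ 180 * a \<le> (\<Sum>m\<in>M. P m * b m ^ 181 * u m ^ 180) + 360 * s ^ 181"
    by (simp add: a_def advantage_eq P_def b_def sum_distrib_left)
  moreover have "s ^ 181 = s ^ 180 * (a / 2)" "s ^ 180 * a = a ^ 181 / 2 ^ 180"
    by (simp_all add: s_def power_divide flip: power_Suc2)
  ultimately have moment: "a ^ 181 / 2 ^ 180 \<le> (\<Sum>m\<in>M. P m * b m ^ 181 * u m ^ 180)"
    by simp
  have "a ^ 181 / 2 ^ 180 * (N powr (- (2 / I)) / (8 ^ 180 * 256))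
      \<le> (\<Sum>m\<in>M. P m * b m ^ 181 * u m ^ 180) * (N powr (- (2 / I)) / (8 ^ 180 * 256))"
    by (intro mult_right_mono moment) simp
  also have "\<dots> = (\<Sum>m\<in>M. \<rho> m * (mass X Y m * b m ^ 181 * u m ^ 180 * N powr (- (2 / I)) / (8 ^ 180 * 256)))"
    unfolding sum_distrib_right by (intro sum.cong) (auto simp: P_def pmf_msg)
  also have "\<dots> \<le> Z"
    unfolding Z_def
  proof (intro sum_mono mult_left_mono \<rho>)
    fix m assume m: "m \<in> M"
    \<comment> \<open>Monotonicity of the mass is the case \<open>g = 0\<close> of the deletion
      bound.\<close>
    have "mass (S m) (T m) m \<le> mass X Y m"
      using good[of m] fin
        sum_rectangle_diff_le[of X Y "S m" "T m" "\<lambda>x y. \<mu> x y * A x m * B y m" "\<lambda>_ _. 0"]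
      by (simp add: mass_def A B)
    then show "mass X Y m * b m ^ 181 * u m ^ 180 * N powr (- (2 / I)) / (8 ^ 180 * 256) \<le> w m"
      unfolding b_def u_def w_def using good[of m] pos[OF m] N I
      by (intro rectangle_weight_ge mass_nonneg discrepancy_le_mass)
        (auto simp: discrepancy_def)
  qed
  finally have Z_ge: "a ^ 181 / 2 ^ 180 * (N powr (- (2 / I)) / (8 ^ 180 * 256)) \<le> Z" .
  have a: "0 < a" using adv by (simp add: a_def)
  then have lb: "0 < a ^ 181 / 2 ^ 180 * (N powr (- (2 / I)) / (8 ^ 180 * 256))" using N by simp
  then have Z: "0 < Z" using Z_ge by linarith
  have "log 2 (a ^ 181 / 2 ^ 180 * (N powr (- (2 / I)) / (8 ^ 180 * 256)))
      = 181 * log 2 a - (2 / I) * log 2 N - 728"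
  proof -
    \<comment> \<open>The exponent is \<open>180 + 3 * 180 + 8\<close>: from the tangent point, the
      factor 8 of discrepancy, and 256.\<close>
    define K where "K = (2 :: real) powr 728"
    have K: "0 < K" "log 2 K = 728" by (simp_all only: K_def log_powr_cancel) simp_all
    have "K = 2 ^ 180 * (8 ^ 180 * 256)" by (simp add: K_def)
    then have "a ^ 181 / 2 ^ 180 * (N powr (- (2 / I)) / (8 ^ 180 * 256)) = a ^ 181 * N powr (- (2 / I)) / K"
      by simp
    then show ?thesis using a N K by (simp only:) (simp add: log_mult log_divide log_nat_power log_powr)
  qed
  then have "181 * log 2 a - (2 / I) * log 2 N - 728 \<le> log 2 Z"
    using log_mono[OF _ lb Z_ge, of 2] by simp
  then have "I * (181 * log 2 a - (2 / I) * log 2 N - 728) \<le> I * log 2 Z"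
    using I by (intro mult_left_mono) auto
  then have "- I * log 2 Z \<le> 2 * log 2 N - 181 * I * log 2 a + 728 * I"
    using I by (simp add: algebra_simps)
  moreover have "marginal_information I p f \<le> ereal (- I * log 2 Z)"
    unfolding Z_def w_def using good I Z
    by (intro marginal_information_le_normalizer) (auto simp: Z_def w_def)
  ultimately show ?thesis
    unfolding a_def by (meson ereal_less_eq(3) order_trans)
qed

end

text \<open>Grouping the transcripts by public randomness, each value \<open>r\<close> contributes
  its probability at most \<open>2 ^ C\<close> times, so \<open>N = 2 ^ C\<close> is
  admissible.\<close>

lemma protocol_marginal_information_le:
  fixes p :: "('x \<times> 'y \<times> 'r transcript) pmf"
  assumes X: "finite X" "finite Y" and p: "protocol_distribution X Y p"
    and I: "1 \<le> I" and adv: "0 < advantage f p"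
  shows "marginal_information I p f
    \<le> ereal (2 * real (communication_complexity p) - 181 * I * log 2 (advantage f p) + 728 * I)"
proof -
  let ?C = "communication_complexity p"
  let ?R = "map_pmf fst (msg_marginal p)"
  let ?M = "set_pmf (msg_marginal p)"
  obtain A B where AB: "\<And>x m. 0 \<le> A x m" "\<And>x m. A x m \<le> 1" "\<And>y m. 0 \<le> B y m" "\<And>y m. B y m \<le> 1"
    "\<And>x y m. pmf p (x, y, m) = pmf (input_marginal p) (x, y) * pmf ?R (fst m) * A x m * B y m"
    using p by (rule protocol_factorization) blast
  have p': "finite (set_pmf p)" "set_pmf p \<subseteq> X \<times> Y \<times> UNIV"
    using p by (auto simp: protocol_distribution_def)
  interpret factored_distribution p X Y "\<lambda>m. pmf ?R (fst m)" A B
    using X p' AB by unfold_locales auto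
  have "(\<Sum>m\<in>?M. pmf ?R (fst m)) = (\<Sum>r\<in>set_pmf ?R. \<Sum>m\<in>{m \<in> ?M. fst m = r}. pmf ?R r)"
    using sum.group[OF finite_M, of "set_pmf ?R" fst "\<lambda>m. pmf ?R (fst m)"] finite_M by simp
  also have "\<dots> \<le> (\<Sum>r\<in>set_pmf ?R. 2 ^ ?C * pmf ?R r)"
  proof (rule sum_mono)
    fix r
    have "{m \<in> ?M. fst m = r} = Pair r ` {ms. (r, ms) \<in> ?M}" by force
    then have "card {m \<in> ?M. fst m = r} \<le> 2 ^ ?C"
      using card_transcripts_le[OF p, of r] by (simp add: card_image inj_on_def)
    then have "real (card {m \<in> ?M. fst m = r}) \<le> real (2 ^ ?C)" by (simp only: of_nat_le_iff)
    then show "(\<Sum>m\<in>{m \<in> ?M. fst m = r}. pmf ?R r) \<le> 2 ^ ?C * pmf ?R r"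
      unfolding sum_constant of_nat_power of_nat_numeral by (rule mult_right_mono) simp
  qed
  also have "\<dots> = 2 ^ ?C * (\<Sum>r\<in>set_pmf ?R. pmf ?R r)" by (simp only: sum_distrib_left)
  also have "(\<Sum>r\<in>set_pmf ?R. pmf ?R r) = 1" using finite_M by (intro sum_pmf_eq_1) auto
  finally have "(\<Sum>m\<in>?M. pmf ?R (fst m)) \<le> 2 ^ ?C" by simp
  from marginal_information_le_advantage[OF I _ this adv] show ?thesis
    by (simp add: log_nat_power)
qed

theorem theorem5:
  shows "\<exists>c::real. c > 0 \<and>
    (\<forall>(I::real) (X::nat set) (Y::nat set) (f::nat \<times> nat \<Rightarrow> nat)
      (p::(nat \<times> nat \<times> nat transcript) pmf) (C::nat).
      I \<ge> 1 \<longrightarrow> finite X \<longrightarrow> finite Y \<longrightarrow> f \<in> X \<times> Y \<rightarrow> {0, 1} \<longrightarrow>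
      protocol_distribution X Y p \<longrightarrow> communication_complexity p = C \<longrightarrow>
      marginal_information I p f
        \<le> ereal (2 * real C) - ereal ((1 + 12 / \<delta>) * I) * elog2 (advantage f p) + ereal (c * I))"
proof (intro exI[of _ 728] conjI allI impI)
  show "(0 :: real) < 728" by simp
next
  fix I :: real and X Y :: "nat set" and f :: "nat \<times> nat \<Rightarrow> nat"
    and p :: "(nat \<times> nat \<times> nat transcript) pmf" and C :: nat
  assume I: "1 \<le> I" and X: "finite X" "finite Y"
    and p: "protocol_distribution X Y p" and C: "communication_complexity p = C"
  have "0 \<le> advantage f p" unfolding advantage_def by simp
  then consider "advantage f p = 0" | "0 < advantage f p" by linarith
  then show "marginal_information I p f
    \<le> ereal (2 * real C) - ereal ((1 + 12 / \<delta>) * I) * elog2 (advantage f p) + ereal (728 * I)"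
  proof cases
    case 1
    \<comment> \<open>Here \<open>elog2\<close> is \<open>-\<infinity>\<close> with a positive
      coefficient, so the right-hand side is \<open>\<infinity>\<close>.\<close>
    then show ?thesis using I by (simp add: elog2_def \<delta>_def)
  next
    case 2
    then show ?thesis
      using protocol_marginal_information_le[OF X p I 2] by (simp add: C elog2_def \<delta>_def)
  qed
qed

end
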